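(* Let $G=(U,V,E)$ be a bipartite graph, let $\nu=|U|$, let $m=|E|$, and let $b_U$ be the bidegeneracy of $U$. The algorithm BBK described below, run on $G$, has time complexity $\mathcal{O}\left((\nu+m)\cdot b_U \cdot 3^{b_U/3}\right)$.
   Context: A bipartite graph is $G=(U,V,E)$ with $U,V$ disjoint vertex sets and $E\subseteq U\times V$ (undirected). For a vertex set $A$, write $A_U=A\cap U$ and $A_V=A\cap V$. $N(x)$ is the neighborhood of $x$ in $G$. For $u\in U$, $N_2(u)$ is the set of neighbors of neighbors of $u$ excluding $u$, and $N^{P}(u)=N(u)\cup N_2(u)$. The bidegeneracy $b(u)$ of $u\in U$ is the maximum $b$ such that some $U'\subseteq U$ with $u\in U'$ satisfies $|N^{P}(x)\cap(U'\cup V)|\ge b$ for all $x\in U'$; $b_U=\max_{u\in U}b(u)$. A bidegeneracy order of $U$ is an ordering $u_1,\dots,u_\nu$ of $U$ such that for each $i$, $u_i$ minimizes $|N^{P}(u)\setminus\{u_1,\dots,u_{i-1}\}|$ over $u\in\{u_i,\dots,u_\nu\}$. Algorithm BBK (enumerating maximal bicliques, i.e. inclusion-maximal sets $C\subseteq U\cup V$ such that every vertex of $C_U$ is adjacent to every vertex of $C_V$): compute a bidegeneracy order $u_1,\dots,u_\nu$ of $U$; for each $i$, set $P_i=N^{P}(u_i)\setminus\{u_1,\dots,u_{i-1}\}$, $X_i=N^{P}(u_i)\cap\{u_1,\dots,u_{i-1}\}$ and call $\mathrm{BKMBE}(\{u_i\},P_i,X_i)$. The recursive procedure $\mathrm{BKMBE}(R,P,X)$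 does: (1) if ($P_U=\emptyset$ or $P_V=\emptyset$) and $X=\emptyset$, output $R\cup P$ as a maximal biclique and return; (2) if ($P_U=\emptyset$ and $X_V\neq\emptyset$) or ($P_V=\emptyset$ and $X_U\ne\emptyset$), return; (3) choose a pivot $p\in P\cup X$ so as to minimize the size of the set $Q$ defined next: if $p\in U$ let $Q=P_V\setminus N(p)$, otherwise $Q=P_U\setminus N(p)$, and if $p\in P$ add $p$ to $Q$; (4) for each $x\in Q$: if $x\in U$ set $P_x=(P_U\setminus\{x\})\cup(P_V\cap N(x))$ and $X_x=X_U\cup(X_V\cap N(x))$, otherwise set $P_x=(P_V\setminus\{x\})\cup(P_U\cap N(x))$ and $X_x=X_V\cup(X_U\cap N(x))$; call $\mathrm{BKMBE}(R\cup\{x\},P_x,X_x)$; then remove $x$ from $P$ and add $x$ to $X$.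
   Formalization: The graph is assumed to have at least one edge: for edgeless graphs b_U is 0 (or undefined if U is empty), so the stated bound would be 0 while the algorithm takes positive time. *)

theory Defs
  imports Complex_Main "HOL-Library.Monad_Syntax"
begin

section \<open>Bipartite graphs and bidegeneracy\<close>

definition bipartite_graph :: "'a set \<Rightarrow> 'a set \<Rightarrow> ('a \<times> 'a) set \<Rightarrow> bool" where
  "bipartite_graph U V E \<longleftrightarrow> finite U \<and> finite V \<and> U \<inter> V = {} \<and> E \<subseteq> U \<times> V"

text \<open>An undirected edge is stored once, as the pair with its endpoint in \<open>U\<close> first.\<close>

definition nbrs :: "('a \<times> 'a) set \<Rightarrow> 'a \<Rightarrow> 'a set" where
  "nbrs E x = {y. (x, y) \<in> E \<or> (y, x) \<in> E}"

definition nbrs2 :: "('a \<times> 'a) set \<Rightarrow> 'a \<Rightarrow> 'a set" where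
  "nbrs2 E u = (\<Union>v \<in> nbrs E u. nbrs E v) - {u}"

definition proj_nbrs :: "('a \<times> 'a) set \<Rightarrow> 'a \<Rightarrow> 'a set" where
  "proj_nbrs E u = nbrs E u \<union> nbrs2 E u"

definition bidegeneracy :: "'a set \<Rightarrow> 'a set \<Rightarrow> ('a \<times> 'a) set \<Rightarrow> 'a \<Rightarrow> nat" where
  "bidegeneracy U V E u =
     Max {b. \<exists>U'. U' \<subseteq> U \<and> u \<in> U' \<and> (\<forall>x\<in>U'. card (proj_nbrs E x \<inter> (U' \<union> V)) \<ge> b)}"

definition bidegeneracy_of_side :: "'a set \<Rightarrow> 'a set \<Rightarrow> ('a \<times> 'a) set \<Rightarrow> nat" where
  "bidegeneracy_of_side U V E = Max (bidegeneracy U V E ` U)"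

definition bidegeneracy_order :: "'a set \<Rightarrow> ('a \<times> 'a) set \<Rightarrow> 'a list \<Rightarrow> bool" where
  "bidegeneracy_order U E us \<longleftrightarrow> distinct us \<and> set us = U \<and>
     (\<forall>i < length us. \<forall>j. i \<le> j \<and> j < length us \<longrightarrow>
        card (proj_nbrs E (us ! i) - set (take i us)) \<le> card (proj_nbrs E (us ! j) - set (take i us)))"

section \<open>Nondeterministic computations with running time\<close>

text \<open>
  \<open>m r t\<close> means that some run of the computation \<open>m\<close> returns \<open>r\<close> after exactly \<open>t\<close> time units.
  Nondeterminism models everything the pseudocode leaves open: how ties are broken and in which
  order a set is traversed.

  The machine is a unit-cost RAM. The following take one time unit (or are grouped, a fixed
  number of them per unit): reading or writing an array cell (an array is a function, written with
  function update); testing whether two vertices are adjacent, or to which side a vertex belongs;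
  inserting into, deleting from, testing membership in, taking some element of, or reading
  the cardinality of a stored finite set. Anything that traverses a set pays for every element
  visited. The input consists of the list \<open>U\<close> and the adjacency list \<open>nbrs E x\<close> of each vertex.
\<close>

type_synonym 'r comp = "'r \<Rightarrow> nat \<Rightarrow> bool"

definition ret :: "'r \<Rightarrow> 'r comp" where
  "ret x = (\<lambda>r t. r = x \<and> t = 0)"

definition bind_comp :: "'r comp \<Rightarrow> ('r \<Rightarrow> 's comp) \<Rightarrow> 's comp" where
  "bind_comp m f = (\<lambda>r t. \<exists>x t1 t2. m x t1 \<and> f x r t2 \<and> t = t1 + t2)"

adhoc_overloading Monad_Syntax.bind \<rightleftharpoons> bind_comp

definition tick :: "nat \<Rightarrow> unit comp" where
  "tick n = (\<lambda>r t. t = n)"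

definition pick :: "'a set \<Rightarrow> 'a comp" where
  "pick S = (\<lambda>x t. x \<in> S \<and> t = 1)"

definition elements :: "'a set \<Rightarrow> 'a list comp" where
  "elements S = (\<lambda>xs t. distinct xs \<and> set xs = S \<and> t = 1 + card S)"

fun for_list :: "('a \<Rightarrow> 's \<Rightarrow> 's comp) \<Rightarrow> 'a list \<Rightarrow> 's \<Rightarrow> 's comp" where
  "for_list f [] s = ret s"
| "for_list f (x # xs) s = do { s' \<leftarrow> f x s; for_list f xs s' }"

definition foreach :: "'a set \<Rightarrow> 's \<Rightarrow> ('a \<Rightarrow> 's \<Rightarrow> 's comp) \<Rightarrow> 's comp" where
  "foreach S s f = do { xs \<leftarrow> elements S; for_list f xs s }"

section \<open>Computing the sets \<open>N\<^sup>P(u)\<close> and a bidegeneracy order\<close>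

definition compute_proj_nbrs :: "('a \<times> 'a) set \<Rightarrow> 'a \<Rightarrow> 'a set comp" where
  "compute_proj_nbrs E u =
     foreach (nbrs E u) {} (\<lambda>v A. do {
       tick 1;
       foreach (nbrs E v) (insert v A) (\<lambda>w A. do {
         tick 1;
         ret (if w = u then A else insert w A) }) })"

definition proj_nbrs_array :: "'a set \<Rightarrow> ('a \<times> 'a) set \<Rightarrow> ('a \<Rightarrow> 'a set) comp" where
  "proj_nbrs_array U E =
     foreach U (\<lambda>_. {}) (\<lambda>u T. do {
       A \<leftarrow> compute_proj_nbrs E u;
       tick 1;
       ret (T(u := A)) })"

text \<open>
  The order is obtained by bucket peeling. \<open>T u\<close> is the set \<open>N\<^sup>P(u)\<close>; for every \<open>u\<close> not yet
  removed, \<open>D u\<close> is the number of elements of \<open>T u\<close> not yet removed, and \<open>u\<close> lies in the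
  bucket \<open>B (D u)\<close>.
\<close>

text \<open>Linear search from index \<open>0\<close>: \<open>k + 1\<close> buckets are inspected.\<close>

definition first_bucket :: "(nat \<Rightarrow> 'a set) \<Rightarrow> nat comp" where
  "first_bucket B = (\<lambda>k t. B k \<noteq> {} \<and> (\<forall>j<k. B j = {}) \<and> t = k + 1)"

definition init_buckets ::
    "'a set \<Rightarrow> ('a \<Rightarrow> 'a set) \<Rightarrow> (('a \<Rightarrow> nat) \<times> (nat \<Rightarrow> 'a set)) comp" where
  "init_buckets U T =
     foreach U (\<lambda>_. 0, \<lambda>_. {}) (\<lambda>u (D, B). do {
       tick 1;
       let k = card (T u);
       ret (D(u := k), B(k := insert u (B k))) })"

definition decrease_key ::
    "'a \<Rightarrow> ('a \<Rightarrow> nat) \<times> (nat \<Rightarrow> 'a set) \<Rightarrow> (('a \<Rightarrow> nat) \<times> (nat \<Rightarrow> 'a set)) comp" where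
  "decrease_key w = (\<lambda>(D, B). do {
     tick 1;
     let k = D w;
     let B = B(k := B k - {w});
     ret (D(w := k - 1), B(k - 1 := insert w (B (k - 1)))) })"

text \<open>The first argument of \<open>peel\<close> counts the iterations left, \<open>us\<close> lists the removed vertices
  (which are also marked, so that \<open>w \<notin> set us\<close> is a constant-time test).\<close>

fun peel :: "nat \<Rightarrow> 'a set \<Rightarrow> ('a \<Rightarrow> 'a set) \<Rightarrow> ('a \<Rightarrow> nat) \<times> (nat \<Rightarrow> 'a set) \<Rightarrow> 'a list
    \<Rightarrow> 'a list comp" where
  "peel 0 U T DB us = ret us"
| "peel (Suc n) U T (D, B) us = do {
     k \<leftarrow> first_bucket B;
     u \<leftarrow> pick (B k);
     DB \<leftarrow> foreach (T u) (D, B(k := B k - {u})) (\<lambda>w DB. do {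
       tick 1;
       if w \<in> U \<and> w \<notin> set us then decrease_key w DB else ret DB });
     tick 1;
     peel n U T DB (us @ [u]) }"

definition compute_order :: "'a set \<Rightarrow> ('a \<Rightarrow> 'a set) \<Rightarrow> 'a list comp" where
  "compute_order U T = do { DB \<leftarrow> init_buckets U T; peel (card U) U T DB [] }"

section \<open>The recursive procedure BKMBE\<close>

definition pivot_set :: "'a set \<Rightarrow> 'a set \<Rightarrow> ('a \<times> 'a) set \<Rightarrow> 'a set \<Rightarrow> 'a \<Rightarrow> 'a set" where
  "pivot_set U V E P p =
     (if p \<in> U then P \<inter> V - nbrs E p else P \<inter> U - nbrs E p) \<union> (if p \<in> P then {p} else {})"

text \<open>
  Every candidate is examined, by one scan of \<open>P\<close> each, and the first minimiser met is kept.
  The traversal order being arbitrary, this can be any minimiser.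
\<close>

definition select_pivot ::
    "'a set \<Rightarrow> 'a set \<Rightarrow> ('a \<times> 'a) set \<Rightarrow> 'a set \<Rightarrow> 'a set \<Rightarrow> 'a option comp" where
  "select_pivot U V E P X =
     foreach (P \<union> X) None (\<lambda>p best. do {
       tick (1 + card P);
       ret (case best of
              None \<Rightarrow> Some p
            | Some q \<Rightarrow> if card (pivot_set U V E P p) < card (pivot_set U V E P q)
                         then Some p else Some q) })"

definition next_P :: "'a set \<Rightarrow> 'a set \<Rightarrow> ('a \<times> 'a) set \<Rightarrow> 'a \<Rightarrow> 'a set \<Rightarrow> 'a set" where
  "next_P U V E x P =
     (if x \<in> U then (P \<inter> U - {x}) \<union> (P \<inter> V \<inter> nbrs E x)
      else (P \<inter> V - {x}) \<union> (P \<inter> U \<inter> nbrs E x))"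

definition next_X :: "'a set \<Rightarrow> 'a set \<Rightarrow> ('a \<times> 'a) set \<Rightarrow> 'a \<Rightarrow> 'a set \<Rightarrow> 'a set" where
  "next_X U V E x X =
     (if x \<in> U then (X \<inter> U) \<union> (X \<inter> V \<inter> nbrs E x)
      else (X \<inter> V) \<union> (X \<inter> U \<inter> nbrs E x))"

text \<open>
  The result is the list of sets output. The test \<open>card P' < card P\<close> is not part of the
  procedure: it always succeeds (see \<open>card_next_P_less\<close> below, with \<open>x \<in> Q \<subseteq> P\<close>) and only makes
  the recursion evidently well-founded. The ticks pay for splitting \<open>P\<close> and \<open>X\<close> into
  their two sides, for writing an output, for building \<open>Q\<close>, and for building \<open>P'\<close> and \<open>X'\<close>.
\<close>

function (sequential)
  bkmbe :: "'a set \<Rightarrow> 'a set \<Rightarrow> ('a \<times> 'a) set \<Rightarrow> 'a set \<Rightarrow> 'a set \<Rightarrow> 'a set \<Rightarrow> 'a set list comp" and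
  bkmbe_loop :: "'a set \<Rightarrow> 'a set \<Rightarrow> ('a \<times> 'a) set \<Rightarrow> 'a set \<Rightarrow> 'a set \<Rightarrow> 'a set \<Rightarrow> 'a list
    \<Rightarrow> 'a set list comp"
where
  "bkmbe U V E R P X = do {
     tick (1 + card P + card X);
     if (P \<inter> U = {} \<or> P \<inter> V = {}) \<and> X = {} then do {
       tick (card (R \<union> P));
       ret [R \<union> P] }
     else if (P \<inter> U = {} \<and> X \<inter> V \<noteq> {}) \<or> (P \<inter> V = {} \<and> X \<inter> U \<noteq> {}) then ret []
     else do {
       p \<leftarrow> select_pivot U V E P X;
       tick (1 + card P);
       let Q = pivot_set U V E P (the p);
       xs \<leftarrow> elements Q;
       bkmbe_loop U V E R P X xs } }"
| "bkmbe_loop U V E R P X [] = ret []"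
| "bkmbe_loop U V E R P X (x # xs) = do {
     tick (1 + card P + card X);
     let P' = next_P U V E x P;
     let X' = next_X U V E x X;
     out1 \<leftarrow> (if card P' < card P then bkmbe U V E (insert x R) P' X' else ret []);
     out2 \<leftarrow> bkmbe_loop U V E R (P - {x}) (insert x X) xs;
     ret (out1 @ out2) }"
  by pat_completeness auto
termination
proof (relation "measures
    [\<lambda>c. case c of Inl (U, V, E, R, P, X) \<Rightarrow> card P | Inr (U, V, E, R, P, X, xs) \<Rightarrow> card P,
     \<lambda>c. case c of Inl _ \<Rightarrow> 1 | Inr _ \<Rightarrow> 0,
     \<lambda>c. case c of Inl _ \<Rightarrow> 0 | Inr (U, V, E, R, P, X, xs) \<Rightarrow> length xs]")
qed (auto simp: card_Diff1_le le_neq_implies_less intro: le_neq_implies_less)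

declare bkmbe.simps [simp del]

lemma card_next_P_less:
  assumes "bipartite_graph U V E" "P \<subseteq> U \<union> V" "x \<in> P"
  shows "card (next_P U V E x P) < card P"
proof (rule psubset_card_mono)
  show "finite P"
    using assms by (auto simp: bipartite_graph_def intro: finite_subset[of P "U \<union> V"])
  show "next_P U V E x P \<subset> P"
    using assms by (auto simp: next_P_def nbrs_def bipartite_graph_def)
qed

section \<open>The algorithm BBK\<close>

fun bbk_loop :: "'a set \<Rightarrow> 'a set \<Rightarrow> ('a \<times> 'a) set \<Rightarrow> ('a \<Rightarrow> 'a set) \<Rightarrow> 'a set \<Rightarrow> 'a list
    \<Rightarrow> 'a set list comp" where
  "bbk_loop U V E T seen [] = ret []"
| "bbk_loop U V E T seen (u # us) = do {
     tick (1 + card (T u));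
     let P = T u - seen;
     let X = T u \<inter> seen;
     out1 \<leftarrow> bkmbe U V E {u} P X;
     out2 \<leftarrow> bbk_loop U V E T (insert u seen) us;
     ret (out1 @ out2) }"

definition bbk :: "'a set \<Rightarrow> 'a set \<Rightarrow> ('a \<times> 'a) set \<Rightarrow> 'a set list comp" where
  "bbk U V E = do {
     tick 1;
     T \<leftarrow> proj_nbrs_array U E;
     us \<leftarrow> compute_order U T;
     bbk_loop U V E T {} us }"

section \<open>The subroutines meet their specifications\<close>

text \<open>
  \<open>ensures m Q\<close>: the computation \<open>m\<close> has a run, and every run returns a result satisfying \<open>Q\<close>.
  The facts below show that the ordering subroutine returns a bidegeneracy order, that the pivot
  minimises the size of \<open>Q\<close>, and that \<open>bbk\<close> has a run on every graph, so that a bound on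
  all its runs is not vacuous.
\<close>

definition ensures :: "'r comp \<Rightarrow> ('r \<Rightarrow> bool) \<Rightarrow> bool" where
  "ensures m Q \<longleftrightarrow> (\<exists>r t. m r t) \<and> (\<forall>r t. m r t \<longrightarrow> Q r)"

lemma ensures_mono: "ensures m Q \<Longrightarrow> (\<And>r. Q r \<Longrightarrow> Q' r) \<Longrightarrow> ensures m Q'"
  by (auto simp: ensures_def)

lemma ensures_ret: "Q x \<Longrightarrow> ensures (ret x) Q"
  by (auto simp: ensures_def ret_def)

lemma ensures_tick: "Q () \<Longrightarrow> ensures (tick n) Q"
  by (auto simp: ensures_def tick_def)

lemma ensures_bind:
  assumes "ensures m R" "\<And>x. R x \<Longrightarrow> ensures (f x) Q"
  shows "ensures (bind_comp m f) Q"
  using assms unfolding ensures_def bind_comp_def by metis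

lemma ensures_tick_bind: "ensures (f ()) Q \<Longrightarrow> ensures (bind_comp (tick n) f) Q"
  by (rule ensures_bind[of _ "\<lambda>_. True"]) (auto intro: ensures_tick)

lemma ensures_pick: "S \<noteq> {} \<Longrightarrow> (\<And>x. x \<in> S \<Longrightarrow> Q x) \<Longrightarrow> ensures (pick S) Q"
  by (auto simp: ensures_def pick_def)

lemma ensures_elements:
  assumes "finite S" "\<And>xs. distinct xs \<Longrightarrow> set xs = S \<Longrightarrow> Q xs"
  shows "ensures (elements S) Q"
  using finite_distinct_list[OF assms(1)] assms(2) by (auto simp: ensures_def elements_def)

lemma ensures_for_list:
  assumes "distinct xs" "I A s" "set xs \<inter> A = {}"
    and "\<And>x A s. x \<in> set xs \<Longrightarrow> x \<notin> A \<Longrightarrow> I A s \<Longrightarrow> ensures (f x s) (I (insert x A))"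
  shows "ensures (for_list f xs s) (I (A \<union> set xs))"
  using assms
proof (induction xs arbitrary: A s)
  case Nil
  then show ?case by (auto intro: ensures_ret)
next
  case (Cons x xs)
  have "ensures (for_list f xs s') (I (insert x A \<union> set xs))" if "I (insert x A) s'" for s'
    using Cons.prems that by (intro Cons.IH) auto
  then show ?case
    using Cons.prems by (auto intro!: ensures_bind[where R = "I (insert x A)"])
qed

lemma ensures_foreach:
  assumes "finite S" "I {} s"
    and "\<And>x A s. x \<in> S \<Longrightarrow> x \<notin> A \<Longrightarrow> I A s \<Longrightarrow> ensures (f x s) (I (insert x A))"
  shows "ensures (foreach S s f) (I S)"
  unfolding foreach_def
proof (rule ensures_bind[OF ensures_elements[OF assms(1)]])
  fix xs assume xs: "distinct xs \<and> set xs = S"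
  show "ensures (for_list f xs s) (I S)"
    using ensures_for_list[of xs I "{}" s f] xs assms by auto
qed auto

lemma finite_nbrs: "bipartite_graph U V E \<Longrightarrow> finite (nbrs E x)"
  by (rule finite_subset[of _ "U \<union> V"]) (auto simp: bipartite_graph_def nbrs_def)

lemma finite_proj_nbrs: "bipartite_graph U V E \<Longrightarrow> finite (proj_nbrs E x)"
  by (auto simp: proj_nbrs_def nbrs2_def finite_nbrs)

lemma compute_proj_nbrs_correct:
  assumes G: "bipartite_graph U V E"
  shows "ensures (compute_proj_nbrs E u) (\<lambda>A. A = proj_nbrs E u)"
proof -
  have "ensures (compute_proj_nbrs E u) (\<lambda>A. A = nbrs E u \<union> ((\<Union>v\<in>nbrs E u. nbrs E v) - {u}))"
    unfolding compute_proj_nbrs_def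
  proof (rule ensures_foreach[where I = "\<lambda>A s. s = A \<union> ((\<Union>v\<in>A. nbrs E v) - {u})"])
    fix x A and s :: "'a set" assume s: "s = A \<union> (\<Union> (nbrs E ` A) - {u})"
    show "ensures (tick 1 \<bind> (\<lambda>_. foreach (nbrs E x) (insert x s)
         (\<lambda>w A. tick 1 \<bind> (\<lambda>_. ret (if w = u then A else insert w A)))))
         (\<lambda>s. s = insert x A \<union> (\<Union> (nbrs E ` insert x A) - {u}))"
      apply (rule ensures_tick_bind)
      apply (rule ensures_mono)
       apply (rule ensures_foreach[where I = "\<lambda>B r. r = insert x s \<union> (B - {u})"])
      using s by (auto intro!: ensures_tick_bind ensures_ret finite_nbrs[OF G])
  qed (auto intro: finite_nbrs[OF G])
  then show ?thesis by (simp add: proj_nbrs_def nbrs2_def)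
qed

lemma proj_nbrs_array_correct:
  assumes G: "bipartite_graph U V E"
  shows "ensures (proj_nbrs_array U E) (\<lambda>T. \<forall>u\<in>U. T u = proj_nbrs E u)"
  unfolding proj_nbrs_array_def
  apply (rule ensures_foreach[where I = "\<lambda>A T. \<forall>u\<in>A. T u = proj_nbrs E u"])
  using G by (auto simp: bipartite_graph_def split: if_splits intro!: ensures_bind[OF compute_proj_nbrs_correct[OF G]]
      ensures_tick_bind ensures_ret)

definition queue_ok :: "'a set \<Rightarrow> ('a \<Rightarrow> nat) \<Rightarrow> ('a \<Rightarrow> nat) \<times> (nat \<Rightarrow> 'a set) \<Rightarrow> bool" where
  "queue_ok W d = (\<lambda>(D, B). (\<forall>w\<in>W. D w = d w) \<and> (\<forall>k. B k = {w \<in> W. d w = k}))"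

lemma queue_ok_cong:
  assumes "\<And>w. w \<in> W \<Longrightarrow> d w = d' w"
  shows "queue_ok W d DB \<longleftrightarrow> queue_ok W d' DB"
proof -
  have "{w \<in> W. d w = k} = {w \<in> W. d' w = k}" for k using assms by auto
  then show ?thesis using assms by (simp add: queue_ok_def split: prod.splits)
qed

lemma init_buckets_correct:
  assumes "finite U"
  shows "ensures (init_buckets U T) (queue_ok U (\<lambda>u. card (T u)))"
  unfolding init_buckets_def
  apply (rule ensures_foreach[where I = "\<lambda>A. queue_ok A (\<lambda>u. card (T u))"])
  using assms by (auto simp: queue_ok_def Let_def split: prod.splits if_splits
      intro!: ensures_tick_bind ensures_ret)

lemma decrease_key_correct:
  assumes "queue_ok W d DB" "w \<in> W" "d w \<noteq> 0" "\<And>x. x \<in> W \<Longrightarrow> d' x = (if x = w then d w - 1 else d x)"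
  shows "ensures (decrease_key w DB) (queue_ok W d')"
  using assms unfolding decrease_key_def
  by (auto simp: queue_ok_def Let_def split: prod.splits if_splits
      intro!: ensures_tick_bind ensures_ret)

lemma peel_correct:
  assumes fin: "finite U" and T: "\<And>u. u \<in> U \<Longrightarrow> finite (T u) \<and> u \<notin> T u"
    and sym: "\<And>u w. u \<in> U \<Longrightarrow> w \<in> U \<Longrightarrow> w \<in> T u \<Longrightarrow> u \<in> T w"
    and "queue_ok (U - set us) (\<lambda>w. card (T w - set us)) DB"
    and "distinct us" "set us \<subseteq> U" "n = card (U - set us)"
    and "\<forall>i<length us. \<forall>w\<in>U - set (take i us).
       card (T (us ! i) - set (take i us)) \<le> card (T w - set (take i us))"
  shows "ensures (peel n U T DB us) (\<lambda>us. distinct us \<and> set us = U \<and>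
    (\<forall>i<length us. \<forall>w\<in>U - set (take i us).
       card (T (us ! i) - set (take i us)) \<le> card (T w - set (take i us))))"
  using assms(4-)
proof (induction n arbitrary: us DB)
  case 0
  then have "set us = U" using fin by auto
  then show ?case using 0 by (auto intro!: ensures_ret)
next
  case (Suc n)
  obtain D B where DB: "DB = (D, B)" by force
  let ?d = "\<lambda>w. card (T w - set us)"
  let ?W = "U - set us"
  have B: "\<And>k. B k = {w \<in> ?W. ?d w = k}" and D: "\<And>w. w \<in> ?W \<Longrightarrow> D w = ?d w"
    using Suc.prems(1) by (auto simp: DB queue_ok_def)
  have ne: "?W \<noteq> {}" using Suc.prems by (metis card.empty nat.distinct(1))
  have fb: "ensures (first_bucket B) (\<lambda>k. B k \<noteq> {} \<and> (\<forall>j<k. B j = {}))"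
  proof -
    define k where "k = (LEAST k. B k \<noteq> {})"
    obtain w where "w \<in> ?W" using ne by blast
    then have "w \<in> B (?d w)" by (simp add: B)
    then have "B (?d w) \<noteq> {}" by blast
    then have "B k \<noteq> {}" unfolding k_def by (rule LeastI)
    moreover have "\<forall>j<k. B j = {}"
      unfolding k_def by (blast dest: not_less_Least)
    ultimately have "first_bucket B k (k + 1)" by (simp add: first_bucket_def)
    then show ?thesis unfolding ensures_def by (auto simp only: first_bucket_def)
  qed
  show ?case unfolding DB peel.simps
  proof (rule ensures_bind[OF fb])
    fix k assume k: "B k \<noteq> {} \<and> (\<forall>j<k. B j = {})"
    have pk: "ensures (pick (B k)) (\<lambda>u. u \<in> B k)"
      by (rule ensures_pick) (use k in auto)
    let ?body = "\<lambda>u. foreach (T u) (D, B(k := B k - {u})) (\<lambda>w DB. do {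
       tick 1;
       if w \<in> U \<and> w \<notin> set us then decrease_key w DB else ret DB }) \<bind>
       (\<lambda>DB. tick 1 \<bind> (\<lambda>_. peel n U T DB (us @ [u])))"
    let ?Q = "\<lambda>us. distinct us \<and> set us = U \<and>
    (\<forall>i<length us. \<forall>w\<in>U - set (take i us).
       card (T (us ! i) - set (take i us)) \<le> card (T w - set (take i us)))"
    have "ensures (?body u) ?Q" if "u \<in> B k" for u
    proof -
      have u: "u \<in> ?W" "?d u = k" using that by (simp_all add: B)
      have min: "?d u \<le> ?d w" if "w \<in> ?W" for w
      proof (rule ccontr)
        assume "\<not> ?d u \<le> ?d w"
        then have "?d w < k" using u(2) by simp
        then have "B (?d w) = {}" using k by blast
        moreover have "w \<in> B (?d w)" using that by (simp add: B)
        ultimately show False by blast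
      qed
      let ?I = "\<lambda>A. queue_ok (?W - {u}) (\<lambda>w. if w \<in> A then card (T w - set us - {u}) else ?d w)"
      have "ensures (foreach (T u) (D, B(k := B k - {u})) (\<lambda>w DB. do {
         tick 1;
         if w \<in> U \<and> w \<notin> set us then decrease_key w DB else ret DB })) (?I (T u))"
      proof (rule ensures_foreach[where I = ?I])
        show "finite (T u)" using T u by auto
        show "?I {} (D, B(k := B k - {u}))" using B D u by (auto simp: queue_ok_def)
        fix w A DB assume w: "w \<in> T u" "w \<notin> A" and I: "?I A DB"
        show "ensures (tick 1 \<bind> (\<lambda>_. if w \<in> U \<and> w \<notin> set us then decrease_key w DB else ret DB))
          (?I (insert w A))"
        proof (rule ensures_tick_bind, cases "w \<in> U \<and> w \<notin> set us")
          case True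
          have wu: "w \<noteq> u" using w u T by auto
          have mem: "u \<in> T w - set us" using sym[of u w] u w True by auto
          have fw: "finite (T w - set us)" using T True by auto
          have nz: "?d w \<noteq> 0" using mem fw by auto
          have "card (T w - set us - {u}) = ?d w - 1"
            using mem by (rule card_Diff_singleton)
          then have "ensures (decrease_key w DB) (?I (insert w A))"
            using wu nz w True by (intro decrease_key_correct[OF I]) auto
          then show "ensures (if w \<in> U \<and> w \<notin> set us then decrease_key w DB else ret DB)
            (?I (insert w A))" using True by simp
        next
          case False
          then have "?I (insert w A) DB" using I by (auto simp: queue_ok_def)
          then show "ensures (if w \<in> U \<and> w \<notin> set us then decrease_key w DB else ret DB)
            (?I (insert w A))" using False by (auto intro: ensures_ret)
        qed
      qed
      then show ?thesis
      proof (rule ensures_bind, intro ensures_tick_bind Suc.IH)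
        fix DB assume I: "?I (T u) DB"
        have e: "(if w \<in> T u then card (T w - set us - {u}) else ?d w) = card (T w - set (us @ [u]))"
          if "w \<in> U - set (us @ [u])" for w
        proof (cases "w \<in> T u")
          case True
          have "T w - set us - {u} = T w - set (us @ [u])" by auto
          then show ?thesis by (simp only: True if_True)
        next
          case False
          then have "u \<notin> T w" using sym[of w u] that u by auto
          then have "T w - set us = T w - set (us @ [u])" by auto
          then show ?thesis by (simp only: False if_False)
        qed
        show "queue_ok (U - set (us @ [u])) (\<lambda>w. card (T w - set (us @ [u]))) DB"
        proof -
          have "?W - {u} = U - set (us @ [u])" by auto
          then have "queue_ok (U - set (us @ [u]))
              (\<lambda>w. if w \<in> T u then card (T w - set us - {u}) else ?d w) DB"
            using I by (simp only:)
          then show ?thesis by (simp only: queue_ok_cong[OF e])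
        qed
        show "distinct (us @ [u])" "set (us @ [u]) \<subseteq> U" using Suc.prems u by auto
        have "U - set (us @ [u]) = ?W - {u}" by auto
        then show "n = card (U - set (us @ [u]))" using Suc.prems u by auto
        show "\<forall>i<length (us @ [u]). \<forall>w\<in>U - set (take i (us @ [u])).
          card (T ((us @ [u]) ! i) - set (take i (us @ [u]))) \<le> card (T w - set (take i (us @ [u])))"
        proof (intro allI impI)
          fix i assume "i < length (us @ [u])"
          then consider "i < length us" | "i = length us" by fastforce
          then show "\<forall>w\<in>U - set (take i (us @ [u])).
            card (T ((us @ [u]) ! i) - set (take i (us @ [u]))) \<le> card (T w - set (take i (us @ [u])))"
            using Suc.prems(5) min by cases (auto simp: nth_append)
        qed
      qed
    qed
    then show "ensures (pick (B k) \<bind> ?body) ?Q"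
      by (rule ensures_bind[OF pk])
  qed
qed

lemma compute_order_correct:
  assumes G: "bipartite_graph U V E" and TE: "\<forall>u\<in>U. T u = proj_nbrs E u"
  shows "ensures (compute_order U T) (bidegeneracy_order U E)"
proof -
  have fin: "finite U" using G by (simp add: bipartite_graph_def)
  have "ensures (compute_order U T) (\<lambda>us. distinct us \<and> set us = U \<and>
    (\<forall>i<length us. \<forall>w\<in>U - set (take i us).
       card (T (us ! i) - set (take i us)) \<le> card (T w - set (take i us))))"
    unfolding compute_order_def
  proof (rule ensures_bind[OF init_buckets_correct[OF fin]], rule peel_correct)
    fix u assume "u \<in> U"
    then show "finite (T u) \<and> u \<notin> T u" using TE G finite_proj_nbrs[OF G]
      by (auto simp: proj_nbrs_def nbrs2_def nbrs_def bipartite_graph_def)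
  next
    fix u w assume "u \<in> U" "w \<in> U" "w \<in> T u"
    then show "u \<in> T w" using TE G
      by (auto simp: proj_nbrs_def nbrs2_def nbrs_def bipartite_graph_def)
  qed (use fin in auto)
  then show ?thesis
  proof (rule ensures_mono)
    fix us assume us: "distinct us \<and> set us = U \<and>
    (\<forall>i<length us. \<forall>w\<in>U - set (take i us).
       card (T (us ! i) - set (take i us)) \<le> card (T w - set (take i us)))"
    have "us ! j \<in> U - set (take i us)" if "i \<le> j" "j < length us" for i j
    proof -
      have "us ! j \<notin> set (take i us)" using us that
        by (auto simp: in_set_conv_nth nth_eq_iff_index_eq)
      then show ?thesis using us that by auto
    qed
    then show "bidegeneracy_order U E us"
      using us TE by (auto simp: bidegeneracy_order_def)
  qed
qed

lemma select_pivot_correct: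
  assumes "finite P" "finite X" "P \<union> X \<noteq> {}"
  shows "ensures (select_pivot U V E P X) (\<lambda>r. \<exists>p\<in>P \<union> X. r = Some p \<and>
    (\<forall>q\<in>P \<union> X. card (pivot_set U V E P p) \<le> card (pivot_set U V E P q)))"
proof -
  let ?c = "\<lambda>p. card (pivot_set U V E P p)"
  let ?I = "\<lambda>A r. case r of None \<Rightarrow> A = {} | Some p \<Rightarrow> p \<in> A \<and> (\<forall>q\<in>A. ?c p \<le> ?c q)"
  have "ensures (select_pivot U V E P X) (?I (P \<union> X))"
    unfolding select_pivot_def
    apply (rule ensures_foreach[where I = ?I])
    using assms(1,2) by (auto intro!: ensures_tick_bind ensures_ret split: option.splits)
  then show ?thesis
    by (rule ensures_mono) (use assms(3) in \<open>auto split: option.splits\<close>)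
qed

lemma bkmbe_total:
  shows "finite P \<Longrightarrow> finite X \<Longrightarrow> ensures (bkmbe U V E R P X) (\<lambda>_. True)"
    and "finite P \<Longrightarrow> finite X \<Longrightarrow> ensures (bkmbe_loop U V E R P X xs) (\<lambda>_. True)"
proof (induction U V E R P X and U V E R P X xs rule: bkmbe_bkmbe_loop.induct)
  case (1 U V E R P X)
  note fin = "1.prems"
  show ?case
  proof (cases "(P \<inter> U = {} \<or> P \<inter> V = {}) \<and> X = {}")
    case True
    then show ?thesis unfolding bkmbe.simps[of U V E R P X]
      by (simp only: simp_thms if_True) (intro ensures_tick_bind ensures_ret TrueI)
  next
    case outer: False
    show ?thesis
    proof (cases "(P \<inter> U = {} \<and> X \<inter> V \<noteq> {}) \<or> (P \<inter> V = {} \<and> X \<inter> U \<noteq> {})")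
      case True
      then show ?thesis unfolding bkmbe.simps[of U V E R P X] if_not_P[OF outer] if_P[OF True]
        by (intro ensures_tick_bind ensures_ret TrueI)
    next
      case False
      have "P \<union> X \<noteq> {}" using outer by blast
      note sp = select_pivot_correct[OF fin this]
      have Q: "finite (pivot_set U V E P p)" for p
        using fin by (simp add: pivot_set_def)
      show ?thesis
        unfolding bkmbe.simps[of U V E R P X] if_not_P[OF outer] if_not_P[OF False] Let_def
        by (rule ensures_tick_bind, rule ensures_bind[OF sp], rule ensures_tick_bind,
            rule ensures_bind[OF ensures_elements[OF Q, where Q = "\<lambda>_. True"]], rule TrueI,
            rule "1.IH"[OF outer False refl fin])
    qed
  qed
next
  case (2 U V E R P X)
  show ?case unfolding bkmbe_loop.simps by (intro ensures_ret TrueI)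
next
  case (3 U V E R P X x xs)
  note fin = "3.prems"
  have P: "finite (next_P U V E x P)" using fin by (simp add: next_P_def)
  have X: "finite (next_X U V E x X)" using fin by (simp add: next_X_def)
  have 1: "ensures (if card (next_P U V E x P) < card P
      then bkmbe U V E (insert x R) (next_P U V E x P) (next_X U V E x X) else ret []) (\<lambda>_. True)"
  proof (cases "card (next_P U V E x P) < card P")
    case True
    show ?thesis unfolding if_P[OF True] by (rule "3.IH"(1)[OF refl refl True P X])
  next
    case False
    show ?thesis unfolding if_not_P[OF False] by (intro ensures_ret TrueI)
  qed
  have 2: "ensures (bkmbe_loop U V E R (P - {x}) (insert x X) xs) (\<lambda>_. True)"
    by (rule "3.IH"(2)) (use fin in simp_all)
  show ?case unfolding bkmbe_loop.simps Let_def
    by (rule ensures_tick_bind, rule ensures_bind[OF 1], rule ensures_bind[OF 2],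
        rule ensures_ret, rule TrueI)
qed

lemma bbk_loop_total:
  "\<forall>u\<in>set us. finite (T u) \<Longrightarrow> ensures (bbk_loop U V E T seen us) (\<lambda>_. True)"
proof (induction us arbitrary: seen)
  case Nil
  show ?case unfolding bbk_loop.simps by (intro ensures_ret TrueI)
next
  case (Cons u us)
  have fin: "finite (T u - seen)" "finite (T u \<inter> seen)" using Cons.prems by simp_all
  have us: "ensures (bbk_loop U V E T (insert u seen) us) (\<lambda>_. True)"
    using Cons.prems by (intro Cons.IH) simp
  show ?case unfolding bbk_loop.simps Let_def
    by (rule ensures_tick_bind, rule ensures_bind[OF bkmbe_total(1)[OF fin]],
        rule ensures_bind[OF us], rule ensures_ret, rule TrueI)
qed

lemma bbk_has_run:
  assumes G: "bipartite_graph U V E"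
  shows "\<exists>out t. bbk U V E out t"
proof -
  have "ensures (bbk U V E) (\<lambda>_. True)"
    unfolding bbk_def
    apply (rule ensures_tick_bind)
    apply (rule ensures_bind[OF proj_nbrs_array_correct[OF G]])
    apply (rule ensures_bind[OF compute_order_correct[OF G]], assumption)
    apply (rule bbk_loop_total)
    using finite_proj_nbrs[OF G] by (auto simp: bidegeneracy_order_def)
  then show ?thesis by (simp add: ensures_def)
qed

end

theory Submission
  imports Defs
begin

text \<open>
  For a node of the recursion tree let \<open>p = |P|\<close> and \<open>S = |R| + |P| + |X|\<close>; the latter never
  increases along the recursion, and the work done at a node is \<open>O(S (1 + p))\<close>. If the pivot set
  has \<open>k\<close> elements, minimality of the pivot means that every \<open>x \<in> Q \<subseteq> P\<close> loses at least \<open>k\<close>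
  candidates, so that there are \<open>k\<close> children with at most \<open>p - k\<close> candidates each. Since
  \<open>k \<le> 3\<^bsup>k/3\<^esup>\<close>, the recurrence solves to \<open>O(S 3\<^bsup>p/3\<^esup>)\<close>. In the top-level call for \<open>u\<close>, the
  bidegeneracy order gives \<open>p \<le> b\<^sub>U\<close>, while \<open>S = 1 + |N\<^sup>P(u)| \<le> 1 + (1 + b\<^sub>U) |N(u)|\<close>: the set
  \<open>U' = N(v)\<close> witnesses \<open>|N(v)| \<le> b\<^sub>U\<close> for \<open>v \<in> V\<close>. Summing over \<open>u\<close> gives the bound, and computing
  the sets \<open>N\<^sup>P(u)\<close> and the order costs only \<open>O((\<nu> + m) b\<^sub>U)\<close>.
\<close>

section \<open>Running times of the basic constructs\<close>

lemma bind_compE: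
  assumes "bind_comp m f r t"
  obtains x t1 t2 where "m x t1" "f x r t2" "t = t1 + t2"
  using assms by (auto simp: bind_comp_def)

lemma tick_bindE:
  assumes "bind_comp (tick n) f r t"
  obtains t' where "f () r t'" "t = n + t'"
  using assms by (auto simp: bind_comp_def tick_def)

lemma ensuresD: "ensures m Q \<Longrightarrow> m r t \<Longrightarrow> Q r"
  by (auto simp: ensures_def)

text \<open>The bound \<open>g x\<close> holds uniformly in the state, so the costs add up without
  any loop invariant.\<close>

lemma for_list_time:
  assumes "for_list f xs s r t"
    and "\<And>x s r t. x \<in> set xs \<Longrightarrow> f x s r t \<Longrightarrow> t \<le> g x"
  shows "t \<le> sum_list (map g xs)"
  using assms
proof (induction xs arbitrary: s t)
  case Nil
  then show ?case by (simp add: ret_def)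
next
  case (Cons x xs)
  from Cons.prems(1) obtain s' t1 t2
    where "f x s s' t1" "for_list f xs s' r t2" "t = t1 + t2"
    by (auto elim: bind_compE)
  with Cons.IH[of s' t2] Cons.prems(2) show ?case
    by (simp add: add_mono)
qed

lemma foreach_time:
  assumes "foreach S s f r t"
    and "\<And>x s r t. x \<in> S \<Longrightarrow> f x s r t \<Longrightarrow> t \<le> g x"
  shows "t \<le> 1 + card S + (\<Sum>x\<in>S. g x)"
proof -
  from assms(1) obtain xs t' where "distinct xs" "set xs = S" "for_list f xs s r t'"
    "t = 1 + card S + t'"
    by (auto simp: foreach_def elements_def elim!: bind_compE)
  with for_list_time[of f xs s r t' g] assms(2) show ?thesis
    by (auto simp: sum_list_distinct_conv_sum_set)
qed

lemma foreach_time_const: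
  assumes "foreach S s f r t"
    and "\<And>x s r t. x \<in> S \<Longrightarrow> f x s r t \<Longrightarrow> t \<le> c"
  shows "t \<le> 1 + card S + card S * c"
  using foreach_time[OF assms(1), of "\<lambda>_. c"] assms(2) by simp

section \<open>Degrees and the bidegeneracy\<close>

lemma proj_nbrs_subset: "bipartite_graph U V E \<Longrightarrow> proj_nbrs E u \<subseteq> U \<union> V"
  by (auto simp: bipartite_graph_def proj_nbrs_def nbrs2_def nbrs_def)

text \<open>The form in which the bidegeneracy is used throughout: one nonempty witness set bounds
  it from below. The set under \<open>Max\<close> is finite because its members are at most
  \<open>card (proj_nbrs E u)\<close>.\<close>

lemma le_bidegeneracy_of_side:
  assumes G: "bipartite_graph U V E" and U': "U' \<subseteq> U" "U' \<noteq> {}"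
    and b: "\<And>x. x \<in> U' \<Longrightarrow> b \<le> card (proj_nbrs E x \<inter> (U' \<union> V))"
  shows "b \<le> bidegeneracy_of_side U V E"
proof -
  obtain u where u: "u \<in> U'" using U' by blast
  let ?B = "{b. \<exists>U'. U' \<subseteq> U \<and> u \<in> U' \<and> (\<forall>x\<in>U'. card (proj_nbrs E x \<inter> (U' \<union> V)) \<ge> b)}"
  have "?B \<subseteq> {..card (proj_nbrs E u)}"
  proof
    fix d assume "d \<in> ?B"
    then obtain W where "d \<le> card (proj_nbrs E u \<inter> (W \<union> V))" by blast
    also have "\<dots> \<le> card (proj_nbrs E u)"
      by (intro card_mono finite_proj_nbrs[OF G]) auto
    finally show "d \<in> {..card (proj_nbrs E u)}" by simp
  qed
  then have "finite ?B" by (rule finite_subset) simp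
  then have "b \<le> bidegeneracy U V E u"
    unfolding bidegeneracy_def by (rule Max_ge) (use u U' b in blast)
  also have "\<dots> \<le> bidegeneracy_of_side U V E"
    unfolding bidegeneracy_of_side_def
    by (rule Max_ge) (use G u U' in \<open>auto simp: bipartite_graph_def\<close>)
  finally show ?thesis .
qed

text \<open>Every \<open>x\<close> in \<open>nbrs E v\<close> reaches the other members of
  \<open>nbrs E v\<close> through \<open>v\<close>, and \<open>v\<close> itself makes up for the
  missing \<open>x\<close>.\<close>

lemma degree_le_bidegeneracy:
  assumes G: "bipartite_graph U V E" and v: "v \<in> V"
  shows "card (nbrs E v) \<le> bidegeneracy_of_side U V E"
proof (cases "nbrs E v = {}")
  case False
  have NU: "nbrs E v \<subseteq> U" using G v by (auto simp: bipartite_graph_def nbrs_def)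
  have vN: "v \<notin> nbrs E v" using G v by (auto simp: bipartite_graph_def nbrs_def)
  note fin = finite_nbrs[OF G, of v]
  show ?thesis
  proof (rule le_bidegeneracy_of_side[OF G NU False])
    fix x assume x: "x \<in> nbrs E v"
    have "card (nbrs E v) = card (insert v (nbrs E v - {x}))"
      using x vN fin by (simp add: card_Suc_Diff1 del: card_Diff_insert)
    also have "\<dots> \<le> card (proj_nbrs E x \<inter> (nbrs E v \<union> V))"
    proof (rule card_mono)
      show "insert v (nbrs E v - {x}) \<subseteq> proj_nbrs E x \<inter> (nbrs E v \<union> V)"
        using x v by (auto simp: proj_nbrs_def nbrs2_def nbrs_def)
    qed (simp add: finite_proj_nbrs[OF G])
    finally show "card (nbrs E v) \<le> card (proj_nbrs E x \<inter> (nbrs E v \<union> V))" .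
  qed
qed simp

text \<open>Each neighbour of \<open>u\<close> lies in \<open>V\<close>; it contributes itself and
  the vertices behind it, whose number is its degree.\<close>

lemma card_proj_nbrs_le:
  assumes G: "bipartite_graph U V E" and u: "u \<in> U"
  shows "card (proj_nbrs E u) \<le> card (nbrs E u) * (1 + bidegeneracy_of_side U V E)"
proof -
  have NV: "nbrs E u \<subseteq> V" using G u by (auto simp: bipartite_graph_def nbrs_def)
  have "proj_nbrs E u \<subseteq> (\<Union>v\<in>nbrs E u. insert v (nbrs E v))"
    by (auto simp: proj_nbrs_def nbrs2_def)
  then have "card (proj_nbrs E u) \<le> card (\<Union>v\<in>nbrs E u. insert v (nbrs E v))"
    by (intro card_mono) (auto simp: finite_nbrs[OF G])
  also have "\<dots> \<le> (\<Sum>v\<in>nbrs E u. card (insert v (nbrs E v)))"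
    by (rule card_UN_le[OF finite_nbrs[OF G]])
  also have "\<dots> \<le> (\<Sum>v\<in>nbrs E u. 1 + bidegeneracy_of_side U V E)"
  proof (rule sum_mono)
    fix v assume "v \<in> nbrs E u"
    then have "card (nbrs E v) \<le> bidegeneracy_of_side U V E"
      using degree_le_bidegeneracy[OF G] NV by blast
    then show "card (insert v (nbrs E v)) \<le> 1 + bidegeneracy_of_side U V E"
      by (simp add: card_insert_if finite_nbrs[OF G])
  qed
  finally show ?thesis by simp
qed

lemma sum_degrees:
  assumes G: "bipartite_graph U V E"
  shows "(\<Sum>u\<in>U. card (nbrs E u)) = card E"
proof -
  have "E = (SIGMA u:U. nbrs E u)"
    using G by (auto simp: bipartite_graph_def nbrs_def)
  moreover have "card (SIGMA u:U. nbrs E u) = (\<Sum>u\<in>U. card (nbrs E u))"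
    by (rule card_SigmaI) (use G finite_nbrs[OF G] in \<open>auto simp: bipartite_graph_def\<close>)
  ultimately show ?thesis by metis
qed

section \<open>Computing the order\<close>

lemma compute_proj_nbrs_time:
  assumes G: "bipartite_graph U V E" and u: "u \<in> U" and run: "compute_proj_nbrs E u A t"
  shows "t \<le> 1 + card (nbrs E u) * (3 + 2 * bidegeneracy_of_side U V E)"
proof -
  \<comment> \<open>A neighbour \<open>v\<close> costs one tick, the listing of
    \<open>nbrs E v\<close>, and one tick per listed vertex; its degree is at most the
    bidegeneracy.\<close>
  have "t \<le> 1 + card (nbrs E u) + card (nbrs E u) * (2 + 2 * bidegeneracy_of_side U V E)"
    using run unfolding compute_proj_nbrs_def
  proof (rule foreach_time_const)
    fix v and A A' :: "'a set" and t assume v: "v \<in> nbrs E u"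
      and "(do { tick 1; foreach (nbrs E v) (insert v A)
        (\<lambda>w A. do { tick 1; ret (if w = u then A else insert w A) }) }) A' t"
    then obtain t' where t': "t = 1 + t'" "foreach (nbrs E v) (insert v A)
        (\<lambda>w A. do { tick 1; ret (if w = u then A else insert w A) }) A' t'"
      by (auto elim: tick_bindE)
    have "t' \<le> 1 + card (nbrs E v) + card (nbrs E v) * 1"
      using t'(2) by (rule foreach_time_const) (auto simp: ret_def elim!: tick_bindE)
    moreover have "card (nbrs E v) \<le> bidegeneracy_of_side U V E"
      by (rule degree_le_bidegeneracy[OF G]) (use G u v in \<open>auto simp: bipartite_graph_def nbrs_def\<close>)
    ultimately show "t \<le> 2 + 2 * bidegeneracy_of_side U V E" using t'(1) by simp
  qed
  then show ?thesis by (simp add: algebra_simps)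
qed

lemma proj_nbrs_array_time:
  assumes G: "bipartite_graph U V E" and run: "proj_nbrs_array U E T t"
  shows "t \<le> 1 + 3 * card U + card E * (3 + 2 * bidegeneracy_of_side U V E)"
proof -
  let ?b = "bidegeneracy_of_side U V E"
  have "t \<le> 1 + card U + (\<Sum>u\<in>U. 2 + card (nbrs E u) * (3 + 2 * ?b))"
    using run unfolding proj_nbrs_array_def
    by (rule foreach_time)
      (auto simp: ret_def elim!: bind_compE tick_bindE dest!: compute_proj_nbrs_time[OF G])
  also have "\<dots> = 1 + 3 * card U + card E * (3 + 2 * ?b)"
    by (simp only: sum.distrib sum_degrees[OF G] flip: sum_distrib_right) simp
  finally show ?thesis .
qed

lemma init_buckets_time: "init_buckets U T DB t \<Longrightarrow> t \<le> 1 + 2 * card U"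
  unfolding init_buckets_def
  by (drule foreach_time_const[where c = 1]) (auto simp: ret_def Let_def elim!: tick_bindE)

lemma decrease_key_time: "decrease_key w DB DB' t \<Longrightarrow> t = 1"
  by (cases DB) (auto simp: decrease_key_def ret_def Let_def elim!: tick_bindE)

section \<open>Peeling with the bucket queue\<close>

text \<open>The time analysis needs exact keys in every intermediate state, since the position of
  the first nonempty bucket determines the cost of the search. In the invariant \<open>?I\<close>,
  \<open>M\<close> holds the vertices of \<open>T u\<close> already visited.\<close>

lemma removal_updates_queue:
  assumes T: "\<And>u. u \<in> U \<Longrightarrow> finite (T u) \<and> u \<notin> T u"
    and sym: "\<And>u w. u \<in> U \<Longrightarrow> w \<in> U \<Longrightarrow> w \<in> T u \<Longrightarrow> u \<in> T w"
    and q: "queue_ok (U - A) (\<lambda>w. card (T w - A)) (D, B)"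
    and u: "u \<in> B k"
  shows "ensures (foreach (T u) (D, B(k := B k - {u}))
      (\<lambda>w DB. do { tick 1; if w \<in> U \<and> w \<notin> A then decrease_key w DB else ret DB }))
    (queue_ok (U - insert u A) (\<lambda>w. card (T w - insert u A)))"
proof -
  have u': "u \<in> U - A" "card (T u - A) = k" using q u by (auto simp: queue_ok_def)
  let ?I = "\<lambda>M. queue_ok (U - insert u A)
    (\<lambda>w. if w \<in> M then card (T w - insert u A) else card (T w - A))"
  have "ensures (foreach (T u) (D, B(k := B k - {u}))
      (\<lambda>w DB. do { tick 1; if w \<in> U \<and> w \<notin> A then decrease_key w DB else ret DB })) (?I (T u))"
  proof (rule ensures_foreach[where I = ?I])
    show "finite (T u)" using T u' by auto
    show "?I {} (D, B(k := B k - {u}))" using q u' by (auto simp: queue_ok_def)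
    fix w M DB assume w: "w \<in> T u" "w \<notin> M" and I: "?I M DB"
    show "ensures (do { tick 1; if w \<in> U \<and> w \<notin> A then decrease_key w DB else ret DB })
        (?I (insert w M))"
    proof (rule ensures_tick_bind, cases "w \<in> U \<and> w \<notin> A")
      case True
      have "u \<in> T w - A" using sym[of u w] u' w True by auto
      moreover have "finite (T w - A)" using T True by auto
      moreover have "T w - insert u A = (T w - A) - {u}" by auto
      ultimately have "card (T w - insert u A) = card (T w - A) - 1" "card (T w - A) \<noteq> 0"
        by (auto simp del: Diff_iff)
      moreover have "w \<noteq> u" using w u' T by auto
      ultimately have "ensures (decrease_key w DB) (?I (insert w M))"
        using w True by (intro decrease_key_correct[OF I]) auto
      then show "ensures (if w \<in> U \<and> w \<notin> A then decrease_key w DB else ret DB) (?I (insert w M))"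
        using True by simp
    next
      case False
      then have "?I (insert w M) DB" using I by (auto simp: queue_ok_def)
      then show "ensures (if w \<in> U \<and> w \<notin> A then decrease_key w DB else ret DB) (?I (insert w M))"
        using False by (auto intro: ensures_ret)
    qed
  qed
  moreover
  have "(if w \<in> T u then card (T w - insert u A) else card (T w - A)) = card (T w - insert u A)"
    if "w \<in> U - insert u A" for w
  proof (cases "w \<in> T u")
    \<comment> \<open>By symmetry \<open>u\<close> is not in \<open>T w\<close> either, so removing
      \<open>u\<close> leaves the key of \<open>w\<close> unchanged.\<close>
    case False
    then have "u \<notin> T w" using sym[of w u] that u' by auto
    then have "T w - insert u A = T w - A" by auto
    then show ?thesis by simp
  qed simp
  then have "?I (T u) = queue_ok (U - insert u A) (\<lambda>w. card (T w - insert u A))"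
    by (intro ext queue_ok_cong)
  ultimately show ?thesis by (simp only:)
qed

text \<open>Hypothesis \<open>b\<close> abstracts the bidegeneracy, with \<open>U - W\<close> as the
  vertices already removed. One round costs \<open>k + 1\<close> for the search, \<open>1\<close>
  for the pick, at most \<open>1 + 3 * card (T u)\<close> for the updates and \<open>1\<close>
  more.\<close>

lemma peel_time:
  assumes fin: "finite U" and T: "\<And>u. u \<in> U \<Longrightarrow> finite (T u) \<and> u \<notin> T u"
    and sym: "\<And>u w. u \<in> U \<Longrightarrow> w \<in> U \<Longrightarrow> w \<in> T u \<Longrightarrow> u \<in> T w"
    and b: "\<And>W k. W \<subseteq> U \<Longrightarrow> W \<noteq> {} \<Longrightarrow> (\<And>w. w \<in> W \<Longrightarrow> k \<le> card (T w - (U - W))) \<Longrightarrow> k \<le> b"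
    and "queue_ok (U - set us) (\<lambda>w. card (T w - set us)) DB" "set us \<subseteq> U"
    and "peel n U T DB us r t"
  shows "t \<le> (\<Sum>u\<in>U - set us. b + 4 + 3 * card (T u))"
  using assms(5-)
proof (induction n arbitrary: us DB t)
  case 0
  then show ?case by (simp add: ret_def)
next
  case (Suc n)
  obtain D B where DB: "DB = (D, B)" by force
  let ?loop = "\<lambda>k u. foreach (T u) (D, B(k := B k - {u}))
      (\<lambda>w DB. do { tick 1; if w \<in> U \<and> w \<notin> set us then decrease_key w DB else ret DB })"
  from Suc.prems(3) obtain k t0 u t1 DB' t2 t3
    where "first_bucket B k t0" "pick (B k) u t1" and loop: "?loop k u DB' t2"
      and rec: "peel n U T DB' (us @ [u]) r t3" and "t = t0 + (t1 + (t2 + (1 + t3)))"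
    unfolding DB peel.simps
    by (elim bind_compE tick_bindE) (rule that, assumption+, simp)
  then have k: "B k \<noteq> {}" "\<forall>j<k. B j = {}" and u: "u \<in> B k"
    and t: "t = (k + 1) + (1 + (t2 + (1 + t3)))"
    by (simp_all add: first_bucket_def pick_def)
  note q = Suc.prems(1)[unfolded DB]
  have step: "ensures (?loop k u) (queue_ok (U - insert u (set us)) (\<lambda>w. card (T w - insert u (set us))))"
    by (rule removal_updates_queue[OF _ _ q u]) (erule T, rule sym)
  have u': "u \<in> U - set us" using q u by (auto simp: queue_ok_def)
  \<comment> \<open>All buckets below \<open>k\<close> are empty, so every remaining vertex has key
    at least \<open>k\<close> and the remaining vertices form the witness set.\<close>
  have "k \<le> b"
  proof (rule b[of "U - set us"])
    fix w assume w: "w \<in> U - set us"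
    have "B (card (T w - set us)) \<noteq> {}" using q w by (auto simp: queue_ok_def)
    then have "k \<le> card (T w - set us)" using k by (meson not_less)
    moreover have "U - (U - set us) = set us" using Suc.prems by auto
    ultimately show "k \<le> card (T w - (U - (U - set us)))" by simp
  qed (use u' in auto)
  moreover have "t2 \<le> 1 + card (T u) + card (T u) * 2"
    using loop by (rule foreach_time_const)
      (auto simp: ret_def elim!: tick_bindE dest: decrease_key_time split: if_splits)
  moreover have "t3 \<le> (\<Sum>u\<in>U - set (us @ [u]). b + 4 + 3 * card (T u))"
    using rec
  proof (rule Suc.IH[rotated 2])
    show "queue_ok (U - set (us @ [u])) (\<lambda>w. card (T w - set (us @ [u]))) DB'"
      using ensuresD[OF step, OF loop] by simp
    show "set (us @ [u]) \<subseteq> U" using Suc.prems u' by auto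
  qed
  moreover have "U - set (us @ [u]) = (U - set us) - {u}" by auto
  ultimately show ?case
    using t sum.remove[of "U - set us" u "\<lambda>u. b + 4 + 3 * card (T u)"] u' fin by simp
qed

lemma compute_order_time:
  assumes G: "bipartite_graph U V E" and TE: "\<forall>u\<in>U. T u = proj_nbrs E u"
    and run: "compute_order U T us t"
  shows "t \<le> 1 + 2 * card U + (\<Sum>u\<in>U. bidegeneracy_of_side U V E + 4 + 3 * card (T u))"
proof -
  have fin: "finite U" using G by (simp add: bipartite_graph_def)
  from run obtain DB t1 t2 where 1: "init_buckets U T DB t1" "t = t1 + t2"
    and 2: "peel (card U) U T DB [] us t2"
    by (auto simp: compute_order_def elim: bind_compE)
  have "t2 \<le> (\<Sum>u\<in>U - set []. bidegeneracy_of_side U V E + 4 + 3 * card (T u))"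
    using _ _ _ _ _ _ 2
  proof (rule peel_time)
    fix u assume "u \<in> U"
    then show "finite (T u) \<and> u \<notin> T u" using TE G finite_proj_nbrs[OF G]
      by (auto simp: proj_nbrs_def nbrs2_def nbrs_def bipartite_graph_def)
  next
    fix u w assume "u \<in> U" "w \<in> U" "w \<in> T u"
    then show "u \<in> T w" using TE G
      by (auto simp: proj_nbrs_def nbrs2_def nbrs_def bipartite_graph_def)
  next
    fix W k assume W: "W \<subseteq> U" "W \<noteq> {}" and k: "\<And>w. w \<in> W \<Longrightarrow> k \<le> card (T w - (U - W))"
    show "k \<le> bidegeneracy_of_side U V E"
    proof (rule le_bidegeneracy_of_side[OF G W])
      fix w assume w: "w \<in> W"
      \<comment> \<open>Inside the disjoint union of \<open>U\<close> and \<open>V\<close>, deleting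
        \<open>U - W\<close> is the same as intersecting with \<open>W \<union> V\<close>.\<close>
      have "T w - (U - W) = proj_nbrs E w \<inter> (W \<union> V)"
        using w W TE G proj_nbrs_subset[OF G, of w] by (auto simp: bipartite_graph_def)
      then show "k \<le> card (proj_nbrs E w \<inter> (W \<union> V))" using k[OF w] by simp
    qed
  next
    show "queue_ok (U - set []) (\<lambda>w. card (T w - set [])) DB"
      using ensuresD[OF init_buckets_correct[OF fin], OF 1(1)] by simp
  qed (use fin in auto)
  with init_buckets_time[OF 1(1)] 1(2) show ?thesis by simp
qed

text \<open>The witness set is the suffix starting at \<open>us ! i\<close>: this vertex minimises
  the number of remaining elements, so every vertex of the suffix has at least as many.\<close>

lemma bidegeneracy_order_card_le:
  assumes G: "bipartite_graph U V E" and ord: "bidegeneracy_order U E us" and i: "i < length us"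
  shows "card (proj_nbrs E (us ! i) - set (take i us)) \<le> bidegeneracy_of_side U V E"
proof (rule le_bidegeneracy_of_side[OF G])
  let ?W = "set (drop i us)"
  have us: "distinct us" "set us = U" using ord by (auto simp: bidegeneracy_order_def)
  show "?W \<subseteq> U" using us set_drop_subset by metis
  show "?W \<noteq> {}" using i by simp
  fix x assume "x \<in> ?W"
  then obtain j' where "j' < length (drop i us)" "drop i us ! j' = x"
    by (metis in_set_conv_nth)
  then obtain j where j: "i \<le> j" "j < length us" "x = us ! j"
    using that[of "i + j'"] i by simp
  have "card (proj_nbrs E (us ! i) - set (take i us)) \<le> card (proj_nbrs E x - set (take i us))"
    using ord j by (auto simp: bidegeneracy_order_def)
  also have "proj_nbrs E x - set (take i us) = proj_nbrs E x \<inter> (?W \<union> V)"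
  proof -
    have "set (take i us) \<union> ?W = U" "set (take i us) \<inter> ?W = {}"
      using us by (metis append_take_drop_id set_append) (metis append_take_drop_id distinct_append us(1))
    moreover have "U \<inter> V = {}" using G by (simp add: bipartite_graph_def)
    ultimately show ?thesis using proj_nbrs_subset[OF G, of x] by blast
  qed
  finally show "card (proj_nbrs E (us ! i) - set (take i us)) \<le> card (proj_nbrs E x \<inter> (?W \<union> V))" .
qed

section \<open>The recursion\<close>

definition cbrt3 :: real where
  "cbrt3 = 3 powr (1/3)"

lemma cbrt3_power: "cbrt3 ^ n = 3 powr (real n / 3)"
  by (simp add: cbrt3_def powr_powr flip: powr_realpow)

text \<open>A rational bound that is good enough for the recurrence: its cube is 64/27.\<close>

lemma cbrt3_ge: "4/3 \<le> cbrt3"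
proof (rule power_le_imp_le_base)
  show "(4/3) ^ Suc 2 \<le> cbrt3 ^ Suc 2"
    by (simp only: cbrt3_power) (simp add: power_divide)
qed (simp add: cbrt3_def)

text \<open>This inequality, tight at \<open>k = 3\<close>, dictates the base of the bound. After
  cubing it reads \<open>k ^ 3 \<le> 3 ^ k\<close>, and from 3 on a step multiplies the left side by
  at most 3.\<close>

lemma le_cbrt3_power: "real k \<le> cbrt3 ^ k"
proof -
  have "k ^ 3 \<le> 3 ^ k"
  proof (cases "k \<le> 3")
    case True
    then have "k = 0 \<or> k = 1 \<or> k = 2 \<or> k = 3" by auto
    then show ?thesis by auto
  next
    case False
    then have "3 \<le> k" by simp
    then show ?thesis
    proof (induction k rule: dec_induct)
      case (step n)
      have "3 * n ^ 2 \<le> n ^ 3" using step.hyps(1) by (simp add: power3_eq_cube power2_eq_square)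
      moreover have "3 * n + 1 \<le> n ^ 3"
      proof -
        have "3 * n + 1 \<le> 3 * n * 3" using step.hyps(1) by simp
        also have "\<dots> \<le> n * n * n" using step.hyps(1) by (intro mult_le_mono) auto
        finally show ?thesis by (simp add: power3_eq_cube)
      qed
      moreover have "Suc n ^ 3 = n ^ 3 + 3 * n ^ 2 + 3 * n + 1"
        by (simp add: power3_eq_cube power2_eq_square algebra_simps)
      ultimately have "Suc n ^ 3 \<le> 3 * n ^ 3" by linarith
      also have "\<dots> \<le> 3 ^ Suc n" using step.IH by simp
      finally show ?case .
    qed simp
  qed
  then have "real k ^ 3 \<le> 3 ^ k" by (metis of_nat_le_iff of_nat_numeral of_nat_power)
  also have "(3::real) ^ k = (cbrt3 ^ 3) ^ k" by (simp add: cbrt3_power del: power_numeral)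
  also have "\<dots> = (cbrt3 ^ k) ^ 3" by (simp add: power_commutes mult.commute flip: power_mult)
  finally have "real k ^ Suc 2 \<le> (cbrt3 ^ k) ^ Suc 2" by (simp add: numeral_3_eq_3)
  then show ?thesis by (rule power_le_imp_le_base) (use cbrt3_ge in auto)
qed

text \<open>Bernoulli's inequality for the base \<open>4/3\<close>; it lets the exponential pay for
  the linear terms of \<open>work\<close>.\<close>

lemma cbrt3_power_ge: "1 + real n / 3 \<le> cbrt3 ^ n"
proof -
  have "1 + real n * (1/3) \<le> (1 + 1/3) ^ n" by (rule Bernoulli_inequality) simp
  also have "\<dots> \<le> cbrt3 ^ n" using cbrt3_ge by (intro power_mono) auto
  finally show ?thesis by simp
qed

text \<open>The subtracted linear term absorbs the work \<open>1 + p\<close> of the recurrence; where it does not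
  suffice, namely for \<open>k = 1\<close>, the gap between \<open>1\<close> and \<open>3\<^bsup>1/3\<^esup>\<close> does.\<close>

definition work :: "nat \<Rightarrow> real" where
  "work p = 9 * cbrt3 ^ p - real p - 5"

lemma work_ge: "1 + real p \<le> work p"
  using cbrt3_power_ge[of p] by (simp add: work_def)

lemma work_le: "work p \<le> 9 * cbrt3 ^ p"
  by (simp add: work_def)

lemma work_mono: "p \<le> q \<Longrightarrow> work p \<le> work q"
proof (induction q rule: dec_induct)
  case (step n)
  have "4/3 * cbrt3 ^ n \<le> cbrt3 * cbrt3 ^ n"
    by (rule mult_right_mono[OF cbrt3_ge]) (use cbrt3_power_ge[of n] in linarith)
  then have "work n \<le> work (Suc n)"
    using cbrt3_power_ge[of n] unfolding work_def power_Suc of_nat_Suc by linarith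
  with step.IH show ?case by simp
qed simp

text \<open>The cost of a node, in units proportional to \<open>S\<close>: \<open>k\<close> children
  with at most \<open>p - k\<close> candidates each, plus local work \<open>1 + p\<close>.\<close>

lemma work_recurrence:
  assumes "k \<le> p"
  shows "real k * work (p - k) + 1 + real p \<le> work p"
proof -
  define n where "n = p - k"
  have p: "p = n + k" using assms by (simp add: n_def)
  note n = cbrt3_power_ge[of n]
  consider "k = 0" | "k = 1" | "k \<ge> 2" by linarith
  then have "real k * work n + 1 + real (n + k) \<le> work (n + k)"
  proof cases
    case 1
    then show ?thesis using work_ge[of n] by simp
  next
    case 2
    \<comment> \<open>The claim reduces to \<open>n + 3 \<le> 9 * (cbrt3 - 1) * cbrt3 ^ n\<close>.
      The bound \<open>4/3\<close> makes the right side at least \<open>3 * cbrt3 ^ n\<close>, which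
      is at least \<open>n + 3\<close>; this is where the factor 9 in \<open>work\<close> comes
      from.\<close>
    have "4/3 * cbrt3 ^ n \<le> cbrt3 * cbrt3 ^ n"
      by (rule mult_right_mono[OF cbrt3_ge]) (use n in linarith)
    then show ?thesis
      using n unfolding 2 work_def power_add power_one_right of_nat_add of_nat_1 by argo
  next
    case 3
    \<comment> \<open>Once the exponentials are compared,
      \<open>2 * n + 2 * k + 6 \<le> k * n + 5 * k\<close> remains. It is an equality at
      \<open>k = 2\<close>, to which the constant 5 in \<open>work\<close> is tuned.\<close>
    have "real k * cbrt3 ^ n \<le> cbrt3 ^ k * cbrt3 ^ n"
      by (rule mult_right_mono[OF le_cbrt3_power]) (use n in linarith)
    moreover have "2 * real n \<le> real k * real n" using 3 by (intro mult_right_mono) auto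
    ultimately show ?thesis using 3 by (simp add: work_def power_add algebra_simps)
  qed
  then show ?thesis by (simp add: p)
qed

section \<open>Cost of the recursive procedure\<close>

text \<open>The candidates lost by branching on \<open>x\<close> are \<open>x\<close> itself and its
  non-neighbours on the opposite side, which is the set that \<open>x\<close> would define as a
  pivot.\<close>

lemma next_P_card_le:
  assumes G: "bipartite_graph U V E" and "finite P" "x \<in> P"
  shows "card (next_P U V E x P) + card (pivot_set U V E P x) \<le> card P"
proof -
  have "next_P U V E x P \<inter> pivot_set U V E P x = {}"
    using G by (auto simp: next_P_def pivot_set_def bipartite_graph_def nbrs_def split: if_splits)
  moreover have "next_P U V E x P \<union> pivot_set U V E P x \<subseteq> P"
    using assms by (auto simp: next_P_def pivot_set_def)
  moreover have "finite (next_P U V E x P)" "finite (pivot_set U V E P x)"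
    using assms(2) by (auto simp: next_P_def pivot_set_def)
  ultimately show ?thesis
    using card_mono[OF assms(2)] by (metis card_Un_disjoint)
qed

text \<open>Here \<open>c\<close> stands for the cost of one child. Moving \<open>x\<close> from
  \<open>P\<close> to \<open>X\<close> preserves the total size, and \<open>next_P\<close> is
  monotone in \<open>P\<close>, so the bounds \<open>S\<close> and \<open>n\<close> survive while
  the loop shrinks \<open>P\<close>.\<close>

lemma bkmbe_loop_time:
  assumes "bkmbe_loop U V E R P X xs out t"
    and "finite R" "finite P" "finite X" "card R + card P + card X \<le> S"
    and "distinct xs" "set xs \<subseteq> P" "\<And>x. x \<in> set xs \<Longrightarrow> card (next_P U V E x P) \<le> n"
    and c: "0 \<le> c" "\<And>R P X out t. bkmbe U V E R P X out t \<Longrightarrow> finite R \<Longrightarrow> finite P \<Longrightarrow> finite X \<Longrightarrow>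
      card R + card P + card X \<le> S \<Longrightarrow> card P \<le> n \<Longrightarrow> real t \<le> c"
  shows "real t \<le> length xs * (1 + real S + c)"
  using assms(1-8)
proof (induction xs arbitrary: P X out t)
  case Nil
  then show ?case by (simp add: ret_def)
next
  case (Cons x xs)
  let ?P = "next_P U V E x P" and ?X = "next_X U V E x X"
  from Cons.prems(1) obtain out1 t1 out2 t2
    where 1: "(if card ?P < card P then bkmbe U V E (insert x R) ?P ?X else ret []) out1 t1"
      and 2: "bkmbe_loop U V E R (P - {x}) (insert x X) xs out2 t2"
      and t: "t = (1 + card P + card X) + (t1 + t2)"
    unfolding bkmbe_loop.simps Let_def
    by (elim bind_compE tick_bindE) (rule that, assumption+, simp add: ret_def)
  have x: "x \<in> P" using Cons.prems by simp
  have P: "card P = Suc (card (P - {x}))" by (rule card.remove[OF Cons.prems(3) x])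
  have "real t1 \<le> c"
  proof (cases "card ?P < card P")
    case True
    from 1 have "bkmbe U V E (insert x R) ?P ?X out1 t1" unfolding if_P[OF True] .
    then show ?thesis
    proof (rule c(2))
      \<comment> \<open>The vertex gained by \<open>R\<close> is offset by the loss of at least one
        candidate.\<close>
      have "card (insert x R) \<le> Suc (card R)" using Cons.prems(2) by (simp add: card_insert_if)
      moreover have "card ?X \<le> card X"
        using Cons.prems(4) by (intro card_mono) (auto simp: next_X_def)
      ultimately show "card (insert x R) + card ?P + card ?X \<le> S"
        using True Cons.prems(5) by linarith
    qed (use Cons.prems in \<open>auto simp: next_P_def next_X_def\<close>)
  next
    case False
    from 1 have "t1 = 0" unfolding if_not_P[OF False] by (simp add: ret_def)
    then show ?thesis using c(1) by simp
  qed
  moreover have "real t2 \<le> length xs * (1 + real S + c)"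
    using 2
  proof (rule Cons.IH)
    have "card (insert x X) \<le> Suc (card X)" using Cons.prems(4) by (simp add: card_insert_if)
    then show "card R + card (P - {x}) + card (insert x X) \<le> S" using P Cons.prems(5) by linarith
    fix y assume "y \<in> set xs"
    then have "card (next_P U V E y P) \<le> n" using Cons.prems(8) by simp
    moreover have "card (next_P U V E y (P - {x})) \<le> card (next_P U V E y P)"
      using Cons.prems(3) by (intro card_mono) (auto simp: next_P_def)
    ultimately show "card (next_P U V E y (P - {x})) \<le> n" by simp
  qed (use Cons.prems in auto)
  moreover have "real (1 + card P + card X) \<le> 1 + real S" using Cons.prems(5) by simp
  ultimately show ?case using t by (simp add: algebra_simps)
qed

lemma select_pivot_time:
  assumes "select_pivot U V E P X r t"
  shows "t \<le> 1 + card (P \<union> X) + card (P \<union> X) * (1 + card P)"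
  using assms unfolding select_pivot_def
  by (rule foreach_time_const) (auto simp: ret_def elim!: tick_bindE)

text \<open>Strong induction on \<open>card P\<close> with \<open>S\<close> fixed, so that all
  descendants are measured against the size at the root.\<close>

lemma bkmbe_time:
  assumes G: "bipartite_graph U V E" and "bkmbe U V E R P X out t"
    and "finite R" "finite P" "finite X" "card R + card P + card X \<le> S" "1 \<le> S"
  shows "real t \<le> 9 * real S * work (card P)"
  using assms(2-)
proof (induction "card P" arbitrary: R P X out t rule: less_induct)
  case less
  note fin = less.prems(2-4)
  let ?p = "card P"
  have node: "9 * real S * (1 + real ?p) \<le> 9 * real S * work ?p"
    by (intro mult_left_mono work_ge) simp
  have SP: "0 \<le> real S * real ?p" by simp
  note cost = node[unfolded distrib_left mult_1_right]
  consider (leaf) "(P \<inter> U = {} \<or> P \<inter> V = {}) \<and> X = {}"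
    | (dead) "\<not> ((P \<inter> U = {} \<or> P \<inter> V = {}) \<and> X = {})"
      "(P \<inter> U = {} \<and> X \<inter> V \<noteq> {}) \<or> (P \<inter> V = {} \<and> X \<inter> U \<noteq> {})"
    | (branch) "\<not> ((P \<inter> U = {} \<or> P \<inter> V = {}) \<and> X = {})"
      "\<not> ((P \<inter> U = {} \<and> X \<inter> V \<noteq> {}) \<or> (P \<inter> V = {} \<and> X \<inter> U \<noteq> {}))"
    by blast
  then show ?case
  proof cases
    case leaf
    from less.prems(1) have "t = 1 + card P + card X + card (R \<union> P)"
      unfolding bkmbe.simps[of U V E R P X] if_P[OF leaf]
      by (auto simp: ret_def elim!: tick_bindE)
    then have "t \<le> 1 + 2 * S" using less.prems(5) card_Un_le[of R P] by linarith
    then have "real t \<le> 3 * real S" using less.prems(6) by linarith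
    then show ?thesis using cost SP less.prems(6) by linarith
  next
    case dead
    from less.prems(1) have "t = 1 + card P + card X"
      unfolding bkmbe.simps[of U V E R P X] if_not_P[OF dead(1)] if_P[OF dead(2)]
      by (auto simp: ret_def elim!: tick_bindE)
    then have "t \<le> 1 + S" using less.prems(5) by linarith
    then have "real t \<le> 2 * real S" using less.prems(6) by linarith
    then show ?thesis using cost SP less.prems(6) by linarith
  next
    case branch
    from less.prems(1) obtain r ts xs tl
      where sel: "select_pivot U V E P X r ts"
        and xs: "distinct xs" "set xs = pivot_set U V E P (the r)"
        and loop: "bkmbe_loop U V E R P X xs out tl"
        and t: "t = (1 + card P + card X) + (ts + ((1 + card P) + ((1 + card (set xs)) + tl)))"
      unfolding bkmbe.simps[of U V E R P X] if_not_P[OF branch(1)] if_not_P[OF branch(2)] Let_def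
      by (auto simp: elements_def elim!: bind_compE tick_bindE)
    let ?k = "length xs"
    have k: "card (set xs) = ?k" using xs(1) by (rule distinct_card)
    have ne: "P \<union> X \<noteq> {}" using branch(1) by blast
    obtain p where p: "r = Some p"
      "\<forall>q\<in>P \<union> X. card (pivot_set U V E P p) \<le> card (pivot_set U V E P q)"
      using ensuresD[OF select_pivot_correct[OF fin(2,3) ne], OF sel] by blast
    have QP: "set xs \<subseteq> P" using xs(2) by (auto simp: pivot_set_def split: if_splits)
    then have kp: "?k \<le> ?p" using k fin(2) card_mono by metis
    \<comment> \<open>The list \<open>xs\<close> enumerates the pivot set of a minimiser, so the
      pivot set of \<open>x\<close> has at least \<open>?k\<close> elements, all lost by branching
      on \<open>x\<close>.\<close>
    have nP: "card (next_P U V E x P) \<le> ?p - ?k" if "x \<in> set xs" for x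
    proof -
      have x: "x \<in> P" using that QP by blast
      have "?k \<le> card (pivot_set U V E P x)" using p x xs(2) k by auto
      with next_P_card_le[OF G fin(2) x] show ?thesis by linarith
    qed
    let ?c = "9 * real S * work (?p - ?k)"
    have "real tl \<le> ?k * (1 + real S + ?c)"
    proof (cases "?k = 0")
      case True
      then show ?thesis using loop by (simp add: ret_def)
    next
      case False
      show ?thesis
        using loop fin less.prems(5) xs(1) QP nP
      proof (rule bkmbe_loop_time)
        show "0 \<le> ?c" using work_ge[of "?p - ?k"] by simp
        fix R' P' X' out' t'
        assume run: "bkmbe U V E R' P' X' out' t'" "finite R'" "finite P'" "finite X'"
          "card R' + card P' + card X' \<le> S" and n: "card P' \<le> ?p - ?k"
        have "real t' \<le> 9 * real S * work (card P')"
          by (rule less.hyps[OF _ run less.prems(6)]) (use n False kp in linarith)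
        also have "\<dots> \<le> ?c" by (intro mult_left_mono work_mono n) simp
        finally show "real t' \<le> ?c" .
      qed
    qed
    also have "\<dots> \<le> ?p + ?p * real S + ?k * ?c"
    proof -
      have "?k * (1 + real S) \<le> ?p * (1 + real S)" using kp by (intro mult_right_mono) auto
      then show ?thesis by (simp add: algebra_simps)
    qed
    finally have tl: "real tl \<le> ?p + ?p * real S + ?k * ?c" .
    have PX: "card (P \<union> X) \<le> S" using card_Un_le[of P X] less.prems(5) by linarith
    then have "ts \<le> 1 + S + S * (1 + ?p)"
      using select_pivot_time[OF sel] by (meson add_mono le_refl mult_le_mono order_trans)
    then have "real ts \<le> 1 + real S + real S * (1 + real ?p)"
      by (metis (mono_tags, lifting) of_nat_1 of_nat_add of_nat_le_iff of_nat_mult)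
    then have ts: "real ts \<le> 1 + 2 * real S + ?p * real S" by (simp add: algebra_simps)
    have "real (1 + card P + card X) \<le> 1 + real S" using less.prems(5) by simp
    then have "real t \<le> 4 + 3 * real S + 3 * real ?p + 2 * (?p * real S) + ?k * ?c"
      using t tl ts kp k by simp
    moreover have "real ?p \<le> ?p * real S" using less.prems(6) by (simp add: mult_le_cancel_left1)
    \<comment> \<open>Since \<open>S\<close> is at least 1, it absorbs the additive constant and the
      terms in \<open>?p\<close> alone.\<close>
    ultimately have "real t \<le> 9 * real S + 9 * (?p * real S) + ?k * ?c"
      using less.prems(6) SP by (simp add: mult.commute)
    also have "\<dots> = 9 * real S * (?k * work (?p - ?k) + 1 + ?p)"
      by (simp add: algebra_simps)
    also have "\<dots> \<le> 9 * real S * work ?p"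
      by (intro mult_left_mono work_recurrence kp) simp
    finally show ?thesis .
  qed
qed

section \<open>The top-level loop and the total\<close>

text \<open>In the call for \<open>u\<close>, the sets \<open>P\<close> and \<open>X\<close>
  partition \<open>T u\<close> and \<open>R\<close> is a singleton, so
  \<open>S = 1 + card (T u)\<close> fits. The general \<open>seen\<close> makes the induction over
  the order go through.\<close>

lemma bbk_loop_time:
  assumes G: "bipartite_graph U V E"
    and "bbk_loop U V E T seen us out t"
    and "\<And>u. u \<in> set us \<Longrightarrow> finite (T u)"
    and "\<And>i. i < length us \<Longrightarrow> card (T (us ! i) - (seen \<union> set (take i us))) \<le> b"
  shows "real t \<le> (\<Sum>u\<leftarrow>us. (1 + real (card (T u))) * (1 + 9 * work b))"
  using assms(2-)
proof (induction us arbitrary: seen out t)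
  case Nil
  then show ?case by (simp add: ret_def)
next
  case (Cons u us)
  from Cons.prems(1) obtain out1 t1 out2 t2
    where 1: "bkmbe U V E {u} (T u - seen) (T u \<inter> seen) out1 t1"
      and 2: "bbk_loop U V E T (insert u seen) us out2 t2"
      and t: "t = (1 + card (T u)) + (t1 + t2)"
    by (auto simp: Let_def ret_def elim!: bind_compE tick_bindE)
  have fin: "finite (T u)" using Cons.prems(2) by simp
  have "T u = (T u - seen) \<union> (T u \<inter> seen)" by blast
  then have "card (T u) = card (T u - seen) + card (T u \<inter> seen)"
    using fin by (metis Diff_disjoint Int_Diff_disjoint card_Un_disjoint finite_Diff finite_Int inf_commute)
  then have S: "card {u} + card (T u - seen) + card (T u \<inter> seen) \<le> 1 + card (T u)" by simp
  have "real t1 \<le> 9 * real (1 + card (T u)) * work (card (T u - seen))"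
    using bkmbe_time[OF G 1 _ _ _ S] fin by simp
  also have "\<dots> \<le> 9 * real (1 + card (T u)) * work b"
    using Cons.prems(3)[of 0] by (intro mult_left_mono work_mono) auto
  finally have "real t1 \<le> 9 * (1 + real (card (T u))) * work b" by simp
  moreover have "real t2 \<le> (\<Sum>u\<leftarrow>us. (1 + real (card (T u))) * (1 + 9 * work b))"
    using 2
  proof (rule Cons.IH)
    fix i assume "i < length us"
    then show "card (T (us ! i) - (insert u seen \<union> set (take i us))) \<le> b"
      using Cons.prems(3)[of "Suc i"] by simp
  qed (use Cons.prems in auto)
  ultimately show ?case using t by (simp add: algebra_simps)
qed

text \<open>Without edges the right-hand side vanishes, through a zero bidegeneracy or an empty
  \<open>U\<close>, while every run takes at least one time unit; hence
  \<open>E \<noteq> {}\<close>.\<close>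

theorem theorem2:
  shows "\<exists>C::real. \<forall>(U::'a set) V E. bipartite_graph U V E \<and> E \<noteq> {} \<longrightarrow>
    (\<forall>out t. bbk U V E out t \<longrightarrow>
      real t \<le> C * ((real (card U) + real (card E)) * real (bidegeneracy_of_side U V E)
                    * 3 powr (real (bidegeneracy_of_side U V E) / 3)))"
proof (intro exI[of _ 177] allI impI, elim conjE)
  \<comment> \<open>The constant is \<open>177 = 13 + 2 * 82\<close>: the preprocessing contributes
    13, \<open>1 + 9 * work ?b \<le> 82 * ?y\<close> gives 82, and the 2 comes from
    \<open>?n + ?m + ?m * ?b \<le> 2 * (?n + ?m) * ?b\<close>.\<close>
  fix U V :: "'a set" and E out t
  assume G: "bipartite_graph U V E" and E: "E \<noteq> {}" and run: "bbk U V E out t"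
  let ?b = "bidegeneracy_of_side U V E" and ?y = "cbrt3 ^ bidegeneracy_of_side U V E"
  have fin: "finite U" using G by (simp add: bipartite_graph_def)
  \<comment> \<open>A single edge makes both \<open>card U\<close> and \<open>?b\<close> at least 1,
    so that terms lacking these factors can be absorbed.\<close>
  obtain u v where uv: "(u, v) \<in> E" "u \<in> U" "v \<in> V"
    using G E by (auto simp: bipartite_graph_def)
  have nu: "1 \<le> card U" using fin uv by (auto simp: Suc_le_eq card_gt_0_iff)
  have "u \<in> nbrs E v" using uv by (simp add: nbrs_def)
  then have "1 \<le> card (nbrs E v)" using finite_nbrs[OF G] by (auto simp: Suc_le_eq card_gt_0_iff)
  then have b1: "1 \<le> ?b" using degree_le_bidegeneracy[OF G uv(3)] by linarith
  from run obtain T t1 us t2 t3 where 1: "proj_nbrs_array U E T t1"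
    and 2: "compute_order U T us t2" and 3: "bbk_loop U V E T {} us out t3"
    and t: "t = 1 + (t1 + (t2 + t3))"
    by (auto simp: bbk_def elim!: bind_compE tick_bindE)
  have T: "\<forall>u\<in>U. T u = proj_nbrs E u" by (rule ensuresD[OF proj_nbrs_array_correct[OF G], OF 1])
  have ord: "bidegeneracy_order U E us" by (rule ensuresD[OF compute_order_correct[OF G T], OF 2])
  then have us: "distinct us" "set us = U" by (auto simp: bidegeneracy_order_def)
  let ?s = "\<Sum>u\<in>U. card (T u)"
  have s: "?s \<le> card E * (1 + ?b)"
  proof -
    have "?s \<le> (\<Sum>u\<in>U. card (nbrs E u) * (1 + ?b))"
      using card_proj_nbrs_le[OF G] T by (intro sum_mono) auto
    also have "\<dots> = card E * (1 + ?b)" by (simp only: sum_degrees[OF G] flip: sum_distrib_right)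
    finally show ?thesis .
  qed
  have "t2 \<le> 1 + 2 * card U + (card U * (?b + 4) + 3 * ?s)"
    using compute_order_time[OF G T 2] by (simp only: sum.distrib sum_constant flip: sum_distrib_left)
      (simp add: algebra_simps)
  with s proj_nbrs_array_time[OF G 1] t
  have "t \<le> 3 + 9 * card U + card U * ?b + 6 * card E + 5 * (card E * ?b) + t3"
    by (simp add: algebra_simps)
  then have "real t \<le> real (3 + 9 * card U + card U * ?b + 6 * card E + 5 * (card E * ?b) + t3)"
    by (simp only: of_nat_le_iff)
  then have order: "real t \<le>
      3 + 9 * real (card U) + real (card U) * ?b + 6 * real (card E) + 5 * (real (card E) * ?b) + t3"
    by simp
  have y1: "1 \<le> ?y" using cbrt3_power_ge[of ?b] by linarith
  have "real t3 \<le> (\<Sum>u\<leftarrow>us. (1 + real (card (T u))) * (1 + 9 * work ?b))"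
    using G 3
  proof (rule bbk_loop_time)
    show "finite (T u)" if "u \<in> set us" for u using that T us finite_proj_nbrs[OF G] by auto
    show "card (T (us ! i) - ({} \<union> set (take i us))) \<le> ?b" if "i < length us" for i
      using bidegeneracy_order_card_le[OF G ord that] T us nth_mem[OF that] by simp
  qed
  also have "\<dots> = (\<Sum>u\<in>U. (1 + real (card (T u))) * (1 + 9 * work ?b))"
    by (simp only: sum_list_distinct_conv_sum_set[OF us(1)] us(2))
  also have "\<dots> = (real (card U) + real ?s) * (1 + 9 * work ?b)"
    by (simp add: sum.distrib flip: sum_distrib_right)
  also have "\<dots> \<le> (real (card U) + real (card E * (1 + ?b))) * (82 * ?y)"
  proof (rule mult_mono)
    show "real (card U) + real ?s \<le> real (card U) + real (card E * (1 + ?b))"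
      using s by (simp only: add_le_cancel_left of_nat_le_iff)
    show "1 + 9 * work ?b \<le> 82 * ?y" using work_le[of ?b] y1 by linarith
    show "0 \<le> 1 + 9 * work ?b" using work_ge[of ?b] by linarith
  qed simp
  finally have t3: "real t3 \<le> 82 * ((real (card U) + real (card E) + real (card E) * ?b) * ?y)"
    by (simp add: algebra_simps)
  let ?n = "real (card U)" and ?m = "real (card E)"
  have A: "z \<le> z * ?b" if "0 \<le> z" for z :: real
    using that b1 by (simp add: mult_le_cancel_left1)
  have "real t \<le> 13 * (?n * ?b) + 11 * (?m * ?b) + t3"
    using order A[of ?n] A[of ?m] nu by linarith
  also have "\<dots> \<le> 13 * ((?n + ?m) * ?b * ?y) + 82 * (2 * (?n + ?m) * ?b * ?y)"
  proof (rule add_mono)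
    have "13 * (?n * ?b) + 11 * (?m * ?b) \<le> 13 * ((?n + ?m) * ?b * 1)"
      by (simp add: algebra_simps)
    also have "\<dots> \<le> 13 * ((?n + ?m) * ?b * ?y)"
      by (intro mult_left_mono y1) auto
    finally show "13 * (?n * ?b) + 11 * (?m * ?b) \<le> 13 * ((?n + ?m) * ?b * ?y)" .
    have "?n + ?m + ?m * ?b \<le> 2 * (?n + ?m) * ?b"
      using A[of ?n] A[of ?m] by (simp add: algebra_simps)
    then have "82 * ((?n + ?m + ?m * ?b) * ?y) \<le> 82 * (2 * (?n + ?m) * ?b * ?y)"
      using y1 by (intro mult_left_mono mult_right_mono) auto
    with t3 show "real t3 \<le> 82 * (2 * (?n + ?m) * ?b * ?y)" by linarith
  qed
  also have "\<dots> = 177 * ((?n + ?m) * ?b * ?y)"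
    by (simp only: mult.assoc)
  finally show "real t \<le> 177 * ((?n + ?m) * ?b * 3 powr (?b / 3))"
    by (simp only: cbrt3_power)
qed

end
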